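(* Consider a first-come-first-served (FCFS) $c$-server queueing system, viewed as a function of (a) the sequence of arrival times $0\le t_1\le t_2\le t_3\le\dots$ of its customers and (b) the sequence of service durations $S_1,S_2,S_3,\dots$ assigned in order of initiation of service, which are positive except for a possible initial subsequence of zeros. Then the system depends monotonically on these inputs, in the following sense: for each $m$, the time $J_m$ of the $m$-th initiation of service and the $m$-th time of departure $D_m$ are increasing functions of the inputs. That is, if $0\le\tilde t_1\le\tilde t_2\le\dots$ and $\tilde S_1,\tilde S_2,\dots$ are inputs of the same kind to a second such system, with initiation times $\tilde J_m$ and departure times $\tilde D_m$, and if $\tilde t_m\ge t_m$ and $\tilde S_m\ge S_m$ for all $m$, then $\tilde J_m\ge J_m$ and $\tilde D_m\ge D_m$ for all $m$. Moreover, if the arrival times are fixed, then for each $t\ge0$ the Kiefer–Wolfowitz workload vector $\mathbf V(t)$ depends monotonically, coordinate by coordinate, on the initial workload vector (measured immediately after time $0$) and on the sequence of service durations corresponding to non-zero arrival times. That is, if two FCFS $c$-server systems have the same arrival times, if their workload vectors immediately after time $0$ satisfy $V(i,0+)\le\tilde V(i,0+)$ for $i=1,\dots,c$, and if $S_n\le\tilde S_n$ for every $n$ with $t_n>0$, then $V(i,t)\le\tilde V(i,t)$ for $i=1,\dots,c$ and all $t\ge0$.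
   Context: "Increasing" means non-decreasing. **FCFS $c$-server system.** In the first part the system is empty before the first arrival. Customers are served in order of arrival (ties broken by index) by $c\ge1$ servers, each customer starting service at the first moment, not before its arrival and not before its predecessors have started service, at which a server is free. So, with $J_0=0$, $$J_m=\min\{u\ge\max(t_m,J_{m-1}):\ \#\{i<m:\ J_i+S_i>u\}\le c-1\}.$$ $D_m$ is the $m$-th departure time in chronological order: the $m$-th smallest, with multiplicity, of the completion times $J_1+S_1,J_2+S_2,\dots$. Under FCFS, order of initiation of service coincides with order of arrival. **Kiefer–Wolfowitz workload vector.** $\mathbf V(t)=(V(1,t)\le\dots\le V(c,t))$ is the vector of residual work at the $c$ servers in increasing order. At each arrival of a customer the service duration of that customer is added to the smallest coordinate and the vector is re-sorted in increasing order; between arrivals each coordinate decreases at unit rate until it reaches $0$ and then stays at $0$ until increased. $\mathbf V(t)$ is taken right-continuous (so $\mathbf V(0)=\mathbf V(0+)$ includes all arrivals at time $0$), and only finitely many customers are supposed to arrive in any bounded time interval whenever $\mathbf V(t)$ is considered. *)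

theory Defs
  imports Complex_Main
begin

text \<open>
  Customers are numbered \<open>1, 2, 3, \<dots>\<close>; the value at index \<open>0\<close> of the sequences \<open>t\<close> of arrival
  times and \<open>S\<close> of service durations is never used.
\<close>

definition arrival_times :: "(nat \<Rightarrow> real) \<Rightarrow> bool" where
  "arrival_times t \<longleftrightarrow> 0 \<le> t 1 \<and> (\<forall>m\<ge>1. t m \<le> t (Suc m))"

definition service_durations :: "(nat \<Rightarrow> real) \<Rightarrow> bool" where
  "service_durations S \<longleftrightarrow>
     (\<forall>m\<ge>1. 0 \<le> S m) \<and> (\<forall>m\<ge>1. S m = 0 \<longrightarrow> (\<forall>i. 1 \<le> i \<and> i \<le> m \<longrightarrow> S i = 0))"

subsection \<open>Initiation and departure times, for a system that starts empty\<close>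

context
  notes conj_cong [fundef_cong]
begin

text \<open>Existence of the minimum is shown in \<open>initiation_time_is_least\<close> below.\<close>

fun initiation_time :: "nat \<Rightarrow> (nat \<Rightarrow> real) \<Rightarrow> (nat \<Rightarrow> real) \<Rightarrow> nat \<Rightarrow> real" where
  "initiation_time c t S 0 = 0"
| "initiation_time c t S (Suc n) =
     (LEAST u. u \<ge> max (t (Suc n)) (initiation_time c t S n) \<and>
        card {i. i \<in> {1..<Suc n} \<and> initiation_time c t S i + S i > u} \<le> c - 1)"

end

definition completion_time :: "nat \<Rightarrow> (nat \<Rightarrow> real) \<Rightarrow> (nat \<Rightarrow> real) \<Rightarrow> nat \<Rightarrow> real" where
  "completion_time c t S i = initiation_time c t S i + S i"

text \<open>
  The \<open>m\<close>-th smallest member, with multiplicity, of the family \<open>C 1, C 2, \<dots>\<close>: the least \<open>u\<close> such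
  that at least \<open>m\<close> indices \<open>i\<close> have \<open>C i \<le> u\<close>. It is attained for the completion times of an
  FCFS system, see \<open>departure_time_is_least\<close> below.
\<close>

definition mth_smallest :: "nat \<Rightarrow> (nat \<Rightarrow> real) \<Rightarrow> real" where
  "mth_smallest m C =
     (LEAST u. \<exists>I. finite I \<and> I \<subseteq> {1..} \<and> card I = m \<and> (\<forall>i\<in>I. C i \<le> u))"

definition departure_time :: "nat \<Rightarrow> (nat \<Rightarrow> real) \<Rightarrow> (nat \<Rightarrow> real) \<Rightarrow> nat \<Rightarrow> real" where
  "departure_time c t S m = mth_smallest m (completion_time c t S)"

subsection \<open>The Kiefer--Wolfowitz workload vector\<close>

text \<open>Vectors are lists of length \<open>c\<close>, so the \<open>i\<close>-th coordinate sits at list position \<open>i - 1\<close>.\<close>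

definition workload_vector :: "nat \<Rightarrow> real list \<Rightarrow> bool" where
  "workload_vector c v \<longleftrightarrow> length v = c \<and> sorted v \<and> (\<forall>x\<in>set v. 0 \<le> x)"

definition drain :: "real \<Rightarrow> real list \<Rightarrow> real list" where
  "drain d v = map (\<lambda>x. max 0 (x - d)) v"

definition add_work :: "real \<Rightarrow> real list \<Rightarrow> real list" where
  "add_work s v = sort ((hd v + s) # tl v)"

text \<open>
  \<open>epoch t n\<close> is the time of the \<open>n\<close>-th arrival, where the \<open>0\<close>-th epoch is the time origin.
  \<open>workload_after w t S n\<close> is the workload vector just after the \<open>n\<close>-th customer has been admitted
  (several customers arriving at the same instant being admitted one by one, in order of index),
  where \<open>w\<close> is the workload vector just before the arrivals at time \<open>0\<close>.
\<close>

definition epoch :: "(nat \<Rightarrow> real) \<Rightarrow> nat \<Rightarrow> real" where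
  "epoch t n = (if n = 0 then 0 else t n)"

fun workload_after :: "real list \<Rightarrow> (nat \<Rightarrow> real) \<Rightarrow> (nat \<Rightarrow> real) \<Rightarrow> nat \<Rightarrow> real list" where
  "workload_after w t S 0 = w"
| "workload_after w t S (Suc n) =
     add_work (S (Suc n)) (drain (epoch t (Suc n) - epoch t n) (workload_after w t S n))"

definition finitely_many_arrivals :: "(nat \<Rightarrow> real) \<Rightarrow> bool" where
  "finitely_many_arrivals t \<longleftrightarrow> (\<forall>x. finite {n. 1 \<le> n \<and> t n \<le> x})"

definition num_arrivals :: "(nat \<Rightarrow> real) \<Rightarrow> real \<Rightarrow> nat" where
  "num_arrivals t x = card {n. 1 \<le> n \<and> t n \<le> x}"

text \<open>Arrivals at time \<open>x\<close> itself are counted, which makes the vector right-continuous in \<open>x\<close>;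
  in particular its value at \<open>0\<close> includes all arrivals at time \<open>0\<close>.\<close>

definition workload :: "real list \<Rightarrow> (nat \<Rightarrow> real) \<Rightarrow> (nat \<Rightarrow> real) \<Rightarrow> real \<Rightarrow> real list" where
  "workload w t S x =
     drain (x - epoch t (num_arrivals t x)) (workload_after w t S (num_arrivals t x))"

definition V :: "real list \<Rightarrow> (nat \<Rightarrow> real) \<Rightarrow> (nat \<Rightarrow> real) \<Rightarrow> nat \<Rightarrow> real \<Rightarrow> real" where
  "V w t S i x = workload w t S x ! (i - 1)"

subsection \<open>Well-definedness\<close>

lemma Least_real_attained:
  fixes P :: "real \<Rightarrow> bool"
  assumes F: "finite F" and ex: "\<exists>u. P u"
    and red: "\<And>u. P u \<Longrightarrow> \<exists>v\<in>F. v \<le> u \<and> P v"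
  shows "P (Least P)" and "\<And>u. P u \<Longrightarrow> Least P \<le> u"
proof -
  let ?G = "{v \<in> F. P v}"
  have fin: "finite ?G" and ne: "?G \<noteq> {}" using F ex red by auto
  have mem: "Min ?G \<in> ?G" using Min_in[OF fin ne] .
  have le: "Min ?G \<le> u" if u: "P u" for u
  proof -
    obtain v where "v \<in> F" "v \<le> u" "P v" using red[OF u] by blast
    then have "Min ?G \<le> v" by (intro Min_le[OF fin]) simp
    then show ?thesis using \<open>v \<le> u\<close> by linarith
  qed
  have eq: "Least P = Min ?G" using mem le by (intro Least_equality) auto
  show "P (Least P)" using mem eq by simp
  show "\<And>u. P u \<Longrightarrow> Least P \<le> u" using le eq by simp
qed

lemma initiation_time_is_least:
  fixes c n :: nat and t S :: "nat \<Rightarrow> real"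
  defines "P \<equiv> \<lambda>u. u \<ge> max (t (Suc n)) (initiation_time c t S n) \<and>
      card {i. i \<in> {1..<Suc n} \<and> initiation_time c t S i + S i > u} \<le> c - 1"
  shows "P (initiation_time c t S (Suc n))"
    and "\<And>u. P u \<Longrightarrow> initiation_time c t S (Suc n) \<le> u"
proof -
  let ?C = "\<lambda>i. initiation_time c t S i + S i"
  let ?a = "max (t (Suc n)) (initiation_time c t S n)"
  let ?F = "insert ?a (?C ` {1..<Suc n})"
  have J: "initiation_time c t S (Suc n) = Least P" unfolding P_def by simp
  have fin: "finite ?F" by simp
  have ex: "P (Max ?F)"
  proof -
    have "{i. i \<in> {1..<Suc n} \<and> ?C i > Max ?F} = {}"
      using Max_ge[OF fin] by (auto simp: not_less)
    moreover have "?a \<le> Max ?F" by (rule Max_ge[OF fin]) simp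
    ultimately show ?thesis unfolding P_def by (simp only: card.empty) simp
  qed
  have red: "\<exists>v\<in>?F. v \<le> u \<and> P v" if u: "P u" for u
  proof -
    let ?G = "{x \<in> ?F. x \<le> u}"
    have G: "finite ?G" "?a \<in> ?G" using u by (auto simp: P_def)
    have mem: "Max ?G \<in> ?G" using Max_in[OF G(1)] G(2) by blast
    have "{i. i \<in> {1..<Suc n} \<and> ?C i > Max ?G} \<subseteq> {i. i \<in> {1..<Suc n} \<and> ?C i > u}"
    proof (clarify, rule ccontr)
      fix i assume i: "i \<in> {1..<Suc n}" "Max ?G < ?C i" "\<not> u < ?C i"
      then have "?C i \<in> ?G" by auto
      from Max_ge[OF G(1) this] i(2) show False by linarith
    qed
    then have "card {i. i \<in> {1..<Suc n} \<and> ?C i > Max ?G}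
        \<le> card {i. i \<in> {1..<Suc n} \<and> ?C i > u}" by (intro card_mono) auto
    moreover have "?a \<le> Max ?G" by (rule Max_ge[OF G])
    ultimately have "P (Max ?G)" using u unfolding P_def by linarith
    then show ?thesis using mem by blast
  qed
  note * = Least_real_attained[of _ P, OF fin exI[of P, OF ex] red]
  show "P (initiation_time c t S (Suc n))" unfolding J by (rule *(1))
  show "\<And>u. P u \<Longrightarrow> initiation_time c t S (Suc n) \<le> u" unfolding J by (rule *(2))
qed

lemma initiation_time_mono: "m \<le> n \<Longrightarrow> initiation_time c t S m \<le> initiation_time c t S n"
proof (induction n rule: dec_induct)
  case (step n)
  then show ?case using initiation_time_is_least(1)[where c=c and t=t and S=S and n=n]
    by (meson max.boundedE order_trans)
qed simp

lemma departure_time_is_least: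
  fixes c m :: nat and t S :: "nat \<Rightarrow> real"
  defines "P \<equiv> \<lambda>u. \<exists>I. finite I \<and> I \<subseteq> {1..} \<and> card I = m \<and> (\<forall>i\<in>I. completion_time c t S i \<le> u)"
  assumes c: "c \<ge> 1" and m: "m \<ge> 1" and S: "service_durations S"
  shows "P (departure_time c t S m)"
    and "\<And>u. P u \<Longrightarrow> departure_time c t S m \<le> u"
proof -
  let ?C = "completion_time c t S"
  let ?J = "initiation_time c t S"
  let ?F = "?C ` {1..<m + c}"
  obtain k where k: "m + c = Suc k" using c by (cases "m + c") auto
  have D: "departure_time c t S m = Least P"
    unfolding P_def departure_time_def mth_smallest_def by simp
  have fin: "finite ?F" by simp
  obtain I0 where I0: "I0 \<subseteq> {1..<m + c}" "card I0 = m" "\<forall>i\<in>I0. ?C i \<le> ?J (m + c)"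
  proof -
    let ?A = "{i. i \<in> {1..<Suc k} \<and> ?J i + S i > ?J (Suc k)}"
    have "card ?A \<le> c - 1"
      using initiation_time_is_least(1)[where c=c and t=t and S=S and n=k] by blast
    moreover have "card ({1..<Suc k} - ?A) = card {1..<Suc k} - card ?A"
      by (intro card_Diff_subset) auto
    ultimately have "m \<le> card ({1..<Suc k} - ?A)" using k c by simp
    then obtain I0 where "I0 \<subseteq> {1..<Suc k} - ?A" "card I0 = m"
      by (meson obtain_subset_with_card_n)
    then have "I0 \<subseteq> {1..<m + c}" "\<forall>i\<in>I0. ?C i \<le> ?J (m + c)"
      unfolding k completion_time_def
      by (auto simp del: initiation_time.simps simp: not_less dest!: subsetD)
    then show ?thesis using that \<open>card I0 = m\<close> by blast
  qed
  have cand: "\<exists>v\<in>?F. v \<le> u \<and> P v"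
    if I: "I \<subseteq> {1..<m + c}" "card I = m" "\<forall>i\<in>I. ?C i \<le> u" for I u
  proof -
    have "finite I" using I(1) finite_subset by blast
    then have f: "finite (?C ` I)" by simp
    have "I \<noteq> {}" using I(2) m by auto
    then have mem: "Max (?C ` I) \<in> ?C ` I" using Max_in[OF f] by simp
    have "\<forall>i\<in>I. ?C i \<le> Max (?C ` I)" using Max_ge[OF f] by blast
    then have "P (Max (?C ` I))"
      unfolding P_def using I \<open>finite I\<close> by (intro exI[of _ I]) auto
    moreover have "Max (?C ` I) \<le> u" "Max (?C ` I) \<in> ?F" using mem I by auto
    ultimately show ?thesis by blast
  qed
  have ex: "\<exists>u. P u" using cand[OF I0] by blast
  have red: "\<exists>v\<in>?F. v \<le> u \<and> P v" if u: "P u" for u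
  proof -
    obtain I where I: "finite I" "I \<subseteq> {1..}" "card I = m" "\<forall>i\<in>I. ?C i \<le> u"
      using u unfolding P_def by blast
    show ?thesis
    proof (cases "I \<subseteq> {1..<m + c}")
      case True
      then show ?thesis using cand I by blast
    next
      case False
      then obtain j where j: "j \<in> I" "j \<ge> m + c" using I(2) by force
      have "0 \<le> S j" using S j m unfolding service_durations_def by auto
      then have "?J (m + c) \<le> u"
        using initiation_time_mono[OF j(2), of c t S] I(4) j(1)
        unfolding completion_time_def by fastforce
      then have "\<forall>i\<in>I0. ?C i \<le> u" using I0(3) by (meson order_trans)
      then show ?thesis using cand I0 by blast
    qed
  qed
  note * = Least_real_attained[of _ P, OF fin ex red]
  show "P (departure_time c t S m)" unfolding D by (rule *(1))
  show "\<And>u. P u \<Longrightarrow> departure_time c t S m \<le> u" unfolding D by (rule *(2))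
qed

lemma workload_vector_drain:
  assumes "workload_vector c v"
  shows "workload_vector c (drain d v)"
proof -
  have "sorted (drain d v)"
    using assms unfolding workload_vector_def drain_def
    by (auto simp: sorted_iff_nth_mono max.coboundedI2)
  then show ?thesis using assms unfolding workload_vector_def drain_def by auto
qed

lemma workload_vector_add_work:
  assumes "c \<ge> 1" "0 \<le> s" "workload_vector c v"
  shows "workload_vector c (add_work s v)"
proof -
  obtain a l where v: "v = a # l" using assms by (cases v) (auto simp: workload_vector_def)
  show ?thesis
    using assms(2,3) unfolding workload_vector_def add_work_def v
    by (simp del: sort_key_simps)
qed

lemma workload_vector_workload:
  assumes "c \<ge> 1" "service_durations S" "workload_vector c w"
  shows "workload_vector c (workload w t S x)"
proof -
  have S: "0 \<le> S (Suc n)" for n using assms(2) unfolding service_durations_def by force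
  have "workload_vector c (workload_after w t S n)" for n
  proof (induction n)
    case (Suc n)
    then show ?case
      using workload_vector_add_work[OF assms(1) S] workload_vector_drain by simp
  qed (use assms in simp)
  then show ?thesis unfolding workload_def by (rule workload_vector_drain)
qed

end

theory Submission
  imports Defs
begin

text \<open>
  For the initiation times, strong induction makes the time \<open>J\<^sub>m\<close> of the larger system
  satisfy the inequalities defining the least value in the smaller one; the same comparison of
  minima then gives the departure times. For the workload vectors, draining and inserting a service
  duration into the sorted vector both preserve the coordinatewise order, so an order present at
  time \<open>0\<close> propagates along the arrivals at positive times.
\<close>

lemma initiation_time_mono_inputs:
  assumes t: "\<And>m. 1 \<le> m \<Longrightarrow> t m \<le> t' m" and S: "\<And>m. 1 \<le> m \<Longrightarrow> S m \<le> S' m"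
  shows "initiation_time c t S m \<le> initiation_time c t' S' m"
proof (induction m rule: less_induct)
  case (less m)
  show ?case
  proof (cases m)
    case (Suc n)
    let ?J = "initiation_time c t S" and ?J' = "initiation_time c t' S'"
    let ?u = "?J' (Suc n)"
    let ?busy = "{i. i \<in> {1..<Suc n} \<and> ?J i + S i > ?u}"
    let ?busy' = "{i. i \<in> {1..<Suc n} \<and> ?J' i + S' i > ?u}"
    have u: "max (t' (Suc n)) (?J' n) \<le> ?u" "card ?busy' \<le> c - 1"
      using initiation_time_is_least(1)[where c=c and t=t' and S=S' and n=n] by blast+
    \<comment> \<open>All earlier completion times enter the count of busy servers, so the
      comparison is needed at every index below \<open>m\<close>; this is why the induction is
      strong.\<close>
    have "?J i + S i \<le> ?J' i + S' i" if "i \<in> {1..<Suc n}" for i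
      using that less.IH[of i] S[of i] Suc by (intro add_mono) auto
    then have "?busy \<subseteq> ?busy'" by fastforce
    then have "card ?busy \<le> card ?busy'" by (intro card_mono) auto
    moreover have "max (t (Suc n)) (?J n) \<le> ?u"
      using u(1) t[of "Suc n"] less.IH[of n] Suc by (auto simp del: initiation_time.simps)
    ultimately have "?J (Suc n) \<le> ?u"
      using u(2) by (intro initiation_time_is_least(2)) linarith
    then show ?thesis unfolding Suc .
  qed simp
qed

text \<open>The two systems may release customers in different orders, so no single customer is
  tracked. Instead, a set of \<open>m\<close> customers that have left the larger system by its
  \<open>m\<close>-th departure has also left the smaller one by then.\<close>

lemma departure_time_mono_inputs:
  assumes "c \<ge> 1" "m \<ge> 1" "service_durations S" "service_durations S'"
    and t: "\<And>m. 1 \<le> m \<Longrightarrow> t m \<le> t' m" and S: "\<And>m. 1 \<le> m \<Longrightarrow> S m \<le> S' m"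
  shows "departure_time c t S m \<le> departure_time c t' S' m"
proof -
  obtain I where I: "finite I" "I \<subseteq> {1..}" "card I = m"
      "\<forall>i\<in>I. completion_time c t' S' i \<le> departure_time c t' S' m"
    using departure_time_is_least(1)[OF assms(1,2,4)] by blast
  have "completion_time c t S i \<le> completion_time c t' S' i" if "1 \<le> i" for i
    unfolding completion_time_def
    using initiation_time_mono_inputs[where t=t and S=S, OF t S] S[OF that] by (intro add_mono)
  then have "\<forall>i\<in>I. completion_time c t S i \<le> departure_time c t' S' m"
    using I(2,4) by (meson atLeast_iff order_trans subsetD)
  then show ?thesis
    using I(1-3) by (intro departure_time_is_least(2)[OF assms(1-3)]) blast
qed

text \<open>Between sorted lists the order compares entries of equal rank, so it survives even when
  \<open>a\<close> and \<open>b\<close> land at different positions.\<close>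

lemma insort_mono:
  fixes a b :: "'a::linorder"
  assumes "list_all2 (\<le>) xs ys" "sorted xs" "sorted ys" "a \<le> b"
  shows "list_all2 (\<le>) (insort a xs) (insort b ys)"
  using assms
proof (induction xs ys arbitrary: a b rule: list_all2_induct)
  case (Cons x xs y ys)
  have IH: "list_all2 (\<le>) (insort p xs) (insort q ys)" if "p \<le> q" for p q
    using Cons.IH Cons.prems that by simp
  \<comment> \<open>These equations settle the mixed cases. If \<open>a\<close> stops before
    \<open>x\<close> while \<open>b\<close> passes \<open>y\<close>, the tails compare by the
    hypothesis for \<open>x\<close> and \<open>b\<close>; in the opposite case by that for
    \<open>a\<close> and \<open>y\<close>.\<close>
  have eq: "insort x xs = x # xs" "insort y ys = y # ys"
    using Cons.prems by (auto intro: insort_is_Cons)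
  show ?case
    using IH[of a b] IH[of x b] IH[of a y] Cons.hyps Cons.prems(3) unfolding eq by auto
qed simp

lemma add_work_mono:
  assumes "workload_vector c v" "workload_vector c v'" "c \<ge> 1"
    and "list_all2 (\<le>) v v'" "s \<le> s'"
  shows "list_all2 (\<le>) (add_work s v) (add_work s' v')"
proof -
  obtain a l where v: "v = a # l" using assms by (cases v) (auto simp: workload_vector_def)
  obtain a' l' where v': "v' = a' # l'" using assms by (cases v') (auto simp: workload_vector_def)
  show ?thesis
    \<comment> \<open>The tail of a sorted vector is sorted, so re-sorting is a single insertion of
      the increased head.\<close>
    using assms unfolding v v' add_work_def workload_vector_def
    by (auto simp: sorted_sort_id intro!: insort_mono)
qed

lemma drain_mono: "list_all2 (\<le>) v v' \<Longrightarrow> list_all2 (\<le>) (drain d v) (drain d v')"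
  unfolding drain_def by (auto simp: list_all2_conv_all_nth max.coboundedI2)

lemma drain_0: "workload_vector c v \<Longrightarrow> drain 0 v = v"
  unfolding drain_def workload_vector_def by (auto intro!: map_idI)

lemma workload_vector_workload_after:
  assumes "c \<ge> 1" "service_durations S" "workload_vector c w"
  shows "workload_vector c (workload_after w t S n)"
proof (induction n)
  case (Suc n)
  have "0 \<le> S (Suc n)" using assms(2) unfolding service_durations_def by simp
  then show ?case
    using workload_vector_add_work[OF assms(1)] workload_vector_drain[OF Suc] by simp
qed (use assms in simp)

text \<open>Arrival times are nondecreasing, so a counted index brings all smaller ones with it.
  Questions about the cardinality \<open>num_arrivals\<close> thus become comparisons of
  indices.\<close>

lemma arrivals_eq_atLeastAtMost:
  assumes "arrival_times t" "finitely_many_arrivals t"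
  shows "{n. 1 \<le> n \<and> t n \<le> x} = {1..num_arrivals t x}" (is "?A = _")
proof -
  have fin: "finite ?A" using assms(2) unfolding finitely_many_arrivals_def by blast
  have mono: "t i \<le> t n" if "1 \<le> i" "i \<le> n" for i n
    using that(2,1) assms(1)
    by (induction n rule: dec_induct) (auto simp: arrival_times_def intro: order_trans)
  have "n \<le> card ?A" if "n \<in> ?A" for n
  proof -
    have "{1..n} \<subseteq> ?A" using that by (auto intro: order_trans[OF mono])
    from card_mono[OF fin this] show ?thesis by simp
  qed
  then have "?A \<subseteq> {1..card ?A}" by auto
  \<comment> \<open>A subset of a finite set with the same cardinality is the whole set.\<close>
  then have "?A = {1..card ?A}" by (intro card_subset_eq) auto
  then show ?thesis unfolding num_arrivals_def .
qed

lemma workload_mono: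
  assumes c: "c \<ge> 1" and t: "arrival_times t" "finitely_many_arrivals t"
    and S: "service_durations S" "service_durations S'"
    and w: "workload_vector c w" "workload_vector c w'"
    and init: "list_all2 (\<le>) (workload w t S 0) (workload w' t S' 0)"
    and le: "\<And>n. 1 \<le> n \<Longrightarrow> t n > 0 \<Longrightarrow> S n \<le> S' n"
    and x: "x \<ge> 0"
  shows "list_all2 (\<le>) (workload w t S x) (workload w' t S' x)"
proof -
  let ?W = "workload_after w t S" and ?W' = "workload_after w' t S'"
  \<comment> \<open>The customers arriving at time 0 are the first \<open>?k\<close>. Their effect
    is contained in the vectors compared by \<open>init\<close>, so the induction starts just after
    them.\<close>
  let ?k = "num_arrivals t 0"
  note wv = workload_vector_workload_after[OF c S(1) w(1), of t]
    workload_vector_workload_after[OF c S(2) w(2), of t]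
  have arr: "1 \<le> n \<and> t n \<le> y \<longleftrightarrow> 1 \<le> n \<and> n \<le> num_arrivals t y" for n y
    using arrivals_eq_atLeastAtMost[OF t, of y] by (auto simp: set_eq_iff)
  have t1: "0 \<le> t n" if "1 \<le> n" for n
    using that t(1)
    by (induction n rule: dec_induct) (auto simp: arrival_times_def intro: order_trans)
  \<comment> \<open>Either \<open>?k = 0\<close> and the epoch is the time origin, or customer
    \<open>?k\<close> arrives at exactly 0, arrival times being nonnegative. Hence
    \<open>workload\<close> at time 0 drains by 0 and equals \<open>?W ?k\<close>.\<close>
  have "epoch t ?k = 0"
    using arr[of ?k 0] t1[of ?k] unfolding epoch_def by auto
  then have base: "list_all2 (\<le>) (?W ?k) (?W' ?k)"
    using init unfolding workload_def by (simp add: drain_0[OF wv(1)] drain_0[OF wv(2)])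
  have "list_all2 (\<le>) (?W n) (?W' n)" if "?k \<le> n" for n
    using that
  proof (induction n rule: dec_induct)
    case (step n)
    \<comment> \<open>An index beyond \<open>?k\<close> is not counted at time 0, so
      \<open>le\<close> applies to it.\<close>
    have "t (Suc n) > 0" using arr[of "Suc n" 0] step.hyps by auto
    then have "S (Suc n) \<le> S' (Suc n)" by (intro le) auto
    then show ?case
      using step.IH wv by (auto intro!: add_work_mono[OF _ _ c] drain_mono workload_vector_drain)
  qed (rule base)
  \<comment> \<open>The induction thus reaches the last arrival up to \<open>x\<close>; the final
    drain is the same in both systems, which share \<open>t\<close>.\<close>
  moreover have "?k \<le> num_arrivals t x"
    using arr[of ?k 0] arr[of ?k x] x by (cases "?k = 0") auto
  ultimately show ?thesis unfolding workload_def by (intro drain_mono)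
qed

theorem theorem3p2:
  fixes c :: nat
  assumes "c \<ge> 1"
  shows
    "(\<forall>t S t' S' :: nat \<Rightarrow> real.
        arrival_times t \<and> service_durations S \<and> arrival_times t' \<and> service_durations S' \<and>
        (\<forall>m\<ge>1. t m \<le> t' m) \<and> (\<forall>m\<ge>1. S m \<le> S' m) \<longrightarrow>
        (\<forall>m\<ge>1. initiation_time c t S m \<le> initiation_time c t' S' m \<and>
                departure_time c t S m \<le> departure_time c t' S' m)) \<and>
     (\<forall>(t :: nat \<Rightarrow> real) (S :: nat \<Rightarrow> real) (S' :: nat \<Rightarrow> real) (w :: real list) (w' :: real list).
        arrival_times t \<and> finitely_many_arrivals t \<and>
        service_durations S \<and> service_durations S' \<and>
        workload_vector c w \<and> workload_vector c w' \<and>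
        (\<forall>i\<in>{1..c}. V w t S i 0 \<le> V w' t S' i 0) \<and>
        (\<forall>n\<ge>1. t n > 0 \<longrightarrow> S n \<le> S' n) \<longrightarrow>
        (\<forall>i\<in>{1..c}. \<forall>x\<ge>0. V w t S i x \<le> V w' t S' i x))"
proof (intro conjI allI impI ballI)
  fix t S t' S' :: "nat \<Rightarrow> real" and m :: nat
  assume "arrival_times t \<and> service_durations S \<and> arrival_times t' \<and> service_durations S' \<and>
        (\<forall>m\<ge>1. t m \<le> t' m) \<and> (\<forall>m\<ge>1. S m \<le> S' m)" and "m \<ge> 1"
  then show "initiation_time c t S m \<le> initiation_time c t' S' m"
    and "departure_time c t S m \<le> departure_time c t' S' m"
    using assms by (blast intro: initiation_time_mono_inputs departure_time_mono_inputs)+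
next
  fix t S S' :: "nat \<Rightarrow> real" and w w' :: "real list" and i :: nat and x :: real
  assume A: "arrival_times t \<and> finitely_many_arrivals t \<and>
        service_durations S \<and> service_durations S' \<and>
        workload_vector c w \<and> workload_vector c w' \<and>
        (\<forall>i\<in>{1..c}. V w t S i 0 \<le> V w' t S' i 0) \<and>
        (\<forall>n\<ge>1. t n > 0 \<longrightarrow> S n \<le> S' n)" and i: "i \<in> {1..c}" and x: "x \<ge> 0"
  have len: "length (workload w t S y) = c" "length (workload w' t S' y) = c" for y
    using A workload_vector_workload[OF assms] by (auto simp: workload_vector_def)
  \<comment> \<open>Coordinates of \<open>V\<close> count from 1 and list positions from 0, hence
    the instance \<open>Suc j\<close>.\<close>
  have "workload w t S 0 ! j \<le> workload w' t S' 0 ! j" if "j < c" for j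
  proof -
    have "Suc j \<in> {1..c}" using that by simp
    then have "V w t S (Suc j) 0 \<le> V w' t S' (Suc j) 0" using A by blast
    then show ?thesis unfolding V_def by simp
  qed
  then have "list_all2 (\<le>) (workload w t S 0) (workload w' t S' 0)"
    by (simp add: list_all2_conv_all_nth len)
  with A x have "list_all2 (\<le>) (workload w t S x) (workload w' t S' x)"
    by (blast intro: workload_mono[OF assms, of t S S' w w' x])
  then show "V w t S i x \<le> V w' t S' i x"
    using i unfolding V_def by (auto simp: list_all2_conv_all_nth len)
qed

end
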